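(* Let $G$ be a finite strongly connected directed graph in which every vertex has at least one outgoing edge, with a fixed cyclic ordering of the edges emanating from each vertex. Let $(w,\rho)$ be a single-chip-and-rotor state on $G$. Then $(w,\rho)$ is recurrent (under the rotor-router operation) if and only if $(w,\rho)$ is a unicycle.
   Context: Directed graphs are finite; self-loops and multiple edges are allowed. A directed graph is strongly connected if for any two distinct vertices $v,w$ there are directed paths from $v$ to $w$ and from $w$ to $v$. For each vertex $v$ a cyclic ordering of the edges emanating from $v$ is fixed, and for an edge $e$ with tail $v$, $e^+$ denotes the next edge after $e$ in this cyclic ordering. Suppose every vertex has at least one outgoing edge (the graph is sink-free). A rotor configuration is a function $\rho$ assigning to each vertex $v$ an edge $\rho(v)$ emanating from $v$. A single-chip-and-rotor state is a pair $(w,\rho)$ where $w$ is a vertex (the location of the chip) and $\rho$ is a rotor configuration. The rotor-router operation sends $(w,\rho)$ to $(w^+,\rho^+)$, where $\rho^+(w)=\rho(w)^+$, $\rho^+(v)=\rho(v)$ for $v\neq w$, and $w^+$ is the head of $\rho(w)^+$. A state $(w,\rho)$ is recurrent if, starting from $(w,\rho)$, iterating the rotor-router operation (some positive number of times) leads back to $(w,\rho)$. A unicycle is a state $(w,\rho)$ for which the set of edges $\{\rho(v)\}$ contains a unique directed cycle and $w$ lies on this cycle. *)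

theory Defs
  imports "Graph_Theory.Graph_Theory" "HOL-Combinatorics.Orbits"
begin

definition sink_free :: "('v, 'e) pre_digraph \<Rightarrow> bool" where
  "sink_free G \<longleftrightarrow> (\<forall>v \<in> verts G. out_arcs G v \<noteq> {})"

text \<open>
  The cyclic orderings at all vertices are given by one successor function \<open>nxt\<close> on edges
  (\<open>nxt e\<close> is \<open>e\<^sup>+\<close>), which permutes the edges emanating from each vertex in a
  single cycle. No ordering is required at a sink, where \<^const>\<open>cyclic_on\<close> would fail.
\<close>

definition edge_ordering :: "('v, 'e) pre_digraph \<Rightarrow> ('e \<Rightarrow> 'e) \<Rightarrow> bool" where
  "edge_ordering G nxt \<longleftrightarrow>
     (\<forall>v \<in> verts G. out_arcs G v \<noteq> {} \<longrightarrow> cyclic_on nxt (out_arcs G v))"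

text \<open>
  The values of a rotor configuration outside \<open>verts G\<close> are unconstrained; the
  rotor-router operation never reads or changes them.
\<close>

definition rotor_config :: "('v, 'e) pre_digraph \<Rightarrow> ('v \<Rightarrow> 'e) \<Rightarrow> bool" where
  "rotor_config G \<rho> \<longleftrightarrow> (\<forall>v \<in> verts G. \<rho> v \<in> out_arcs G v)"

type_synonym ('v, 'e) chip_rotor = "'v \<times> ('v \<Rightarrow> 'e)"

definition chip_rotor_state :: "('v, 'e) pre_digraph \<Rightarrow> ('v, 'e) chip_rotor \<Rightarrow> bool" where
  "chip_rotor_state G = (\<lambda>(w, \<rho>). w \<in> verts G \<and> rotor_config G \<rho>)"

definition rotor_router ::
    "('v, 'e) pre_digraph \<Rightarrow> ('e \<Rightarrow> 'e) \<Rightarrow> ('v, 'e) chip_rotor \<Rightarrow> ('v, 'e) chip_rotor" where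
  "rotor_router G nxt = (\<lambda>(w, \<rho>). (head G (nxt (\<rho> w)), \<rho>(w := nxt (\<rho> w))))"

definition recurrent ::
    "('v, 'e) pre_digraph \<Rightarrow> ('e \<Rightarrow> 'e) \<Rightarrow> ('v, 'e) chip_rotor \<Rightarrow> bool" where
  "recurrent G nxt s \<longleftrightarrow> (\<exists>n > 0. (rotor_router G nxt ^^ n) s = s)"

text \<open>
  \<^const>\<open>pre_digraph.cycle\<close> describes a directed cycle as the list of its edges from a
  chosen starting vertex (loops included). Passing to edge sets identifies the rotations of
  such a list, so that uniqueness of a cycle is not affected by the choice of starting vertex.
\<close>

definition directed_cycle :: "('v, 'e) pre_digraph \<Rightarrow> 'e set \<Rightarrow> bool" where
  "directed_cycle G C \<longleftrightarrow> (\<exists>p. pre_digraph.cycle G p \<and> C = set p)"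

definition unicycle :: "('v, 'e) pre_digraph \<Rightarrow> ('v, 'e) chip_rotor \<Rightarrow> bool" where
  "unicycle G = (\<lambda>(w, \<rho>). chip_rotor_state G (w, \<rho>) \<and>
     (\<exists>C. directed_cycle G C \<and> C \<subseteq> \<rho> ` verts G \<and>
        (\<forall>C'. directed_cycle G C' \<and> C' \<subseteq> \<rho> ` verts G \<longrightarrow> C' = C) \<and>
        w \<in> tail G ` C))"

end

theory Submission
  imports Defs
begin

text \<open>
  A rotor configuration \<open>\<rho>\<close> turns the vertices into a functional graph, and \<open>(w, \<rho>)\<close> is a
  unicycle iff every vertex leads to \<open>w\<close> in it. Vertices that lead to the chip keep doing so after
  a step, as do the vertices that the chip visits. A recurrent chip visits every vertex, because each
  visited vertex fires all its edges in turn; hence every vertex leads to the chip. Conversely, the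
  router maps unicycles to unicycles and is injective on them: the previous position of the chip is
  the predecessor of the present one on the cycle. So it permutes a finite set of unicycles.
\<close>

section \<open>Periodic points and orbits of a self-map\<close>

lemma funpow_self_in_orbit: "(f ^^ n) x = x \<Longrightarrow> n > 0 \<Longrightarrow> x \<in> orbit f x"
  unfolding orbit_altdef by force

lemma finite_orbit_returns:
  assumes "finite A" "f ` A \<subseteq> A" "x \<in> A"
  obtains i d where "d > 0" "(f ^^ i) x = (f ^^ (i + d)) x"
proof -
  have "(f ^^ n) x \<in> A" for n
    using assms by (induction n) auto
  then have "finite (range (\<lambda>n. (f ^^ n) x))"
    using assms(1) by (meson finite_subset image_subsetI)
  then have "\<not> inj (\<lambda>n. (f ^^ n) x)"
    using finite_imageD by fastforce
  then obtain i j where "i < j" "(f ^^ i) x = (f ^^ j) x"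
    unfolding inj_def by (metis linorder_neqE_nat)
  then show thesis
    using that[of "j - i" i] by simp
qed

text \<open>Cancelling the \<open>i\<close> leading steps by injectivity turns the repetition found
  by pigeonhole into a return to \<open>x\<close> itself.\<close>

lemma inj_on_self_in_orbit:
  assumes "finite A" "f ` A \<subseteq> A" "inj_on f A" "x \<in> A"
  shows "x \<in> orbit f x"
proof -
  have A: "(f ^^ n) x \<in> A" for n
    using assms by (induction n) auto
  have cancel: "(f ^^ i) x = (f ^^ (i + d)) x \<Longrightarrow> x = (f ^^ d) x" for i d
  proof (induction i)
    case (Suc i)
    then have "(f ^^ i) x = (f ^^ (i + d)) x"
      using inj_onD[OF assms(3) _ A A] by simp
    then show ?case by (rule Suc.IH)
  qed simp
  obtain i d where "d > 0" "(f ^^ i) x = (f ^^ (i + d)) x"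
    using finite_orbit_returns[OF assms(1,2,4)] .
  then show ?thesis
    using cancel funpow_self_in_orbit by metis
qed

lemma periodic_orbit_eq:
  assumes "y \<in> orbit f y" "z \<in> orbit f y"
  shows "orbit f z = orbit f y"
  using assms by (metis cyclic_on_singleI orbit_cyclic_eq3)

text \<open>On a periodic orbit \<open>f\<close> is onto, and a map of a finite set onto itself is
  injective.\<close>

lemma inj_on_periodic_orbit:
  assumes "y \<in> orbit f y"
  shows "inj_on f (orbit f y)"
proof (rule inj_onI)
  have card: "card (f ` orbit f y) = card (orbit f y)"
  proof (rule arg_cong[where f = card])
    show "f ` orbit f y = orbit f y"
    proof
      show "f ` orbit f y \<subseteq> orbit f y" by (auto intro: orbit.step)
      show "orbit f y \<subseteq> f ` orbit f y"
      proof
        fix z assume "z \<in> orbit f y"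
        then show "z \<in> f ` orbit f y" using assms by cases auto
      qed
    qed
  qed
  fix a b assume "a \<in> orbit f y" "b \<in> orbit f y" "f a = f b"
  then show "a = b"
    using eq_card_imp_inj_on[OF finite_orbit[OF assms] card] by (auto dest: inj_onD)
qed

section \<open>Rotor arrows and their change under a router step\<close>

definition rotor_succ :: "('v, 'e) pre_digraph \<Rightarrow> ('v \<Rightarrow> 'e) \<Rightarrow> 'v \<Rightarrow> 'v" where
  "rotor_succ G \<rho> v = head G (\<rho> v)"

text \<open>Zero steps are allowed, so the chip's own vertex leads to the chip;
  \<open>orbit\<close>, in contrast, takes at least one step.\<close>

definition leads_to :: "('v, 'e) pre_digraph \<Rightarrow> ('v, 'e) chip_rotor \<Rightarrow> 'v \<Rightarrow> bool" where
  "leads_to G = (\<lambda>(w, \<rho>) v. \<exists>n. (rotor_succ G \<rho> ^^ n) v = w)"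

lemma rotor_router_simps:
  "fst (rotor_router G nxt s) = head G (nxt (snd s (fst s)))"
  "snd (rotor_router G nxt s) = (snd s)(fst s := nxt (snd s (fst s)))"
  by (simp_all add: rotor_router_def split: prod.split)

lemma rotor_succ_router:
  "rotor_succ G (snd (rotor_router G nxt s)) =
     (rotor_succ G (snd s))(fst s := fst (rotor_router G nxt s))"
  by (auto simp: rotor_succ_def rotor_router_simps)

text \<open>Up to its first visit to \<open>w\<close> the path never uses the value at
  \<open>w\<close>, so it survives the update; one further step then follows the new arrow.\<close>

lemma funpow_update_reaches:
  "(f ^^ n) v = w \<Longrightarrow> \<exists>m. ((f(w := w')) ^^ m) v = w \<and> ((f(w := w')) ^^ Suc m) v = w'"
proof (induction n arbitrary: v)
  case (Suc n)
  show ?case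
  proof (cases "v = w")
    case False
    have "(f ^^ n) (f v) = w"
      using Suc.prems by (simp add: funpow_swap1)
    then obtain m where "((f(w := w')) ^^ m) (f v) = w" "((f(w := w')) ^^ Suc m) (f v) = w'"
      using Suc.IH by blast
    moreover have "((f(w := w')) ^^ Suc k) v = ((f(w := w')) ^^ k) (f v)" for k
      using False by (simp del: funpow.simps add: funpow_Suc_right)
    ultimately show ?thesis by metis
  qed (auto intro: exI[of _ 0])
qed (auto intro: exI[of _ 0])

lemma leads_to_router:
  assumes "leads_to G s v"
  shows "leads_to G (rotor_router G nxt s) v"
proof -
  obtain n where "(rotor_succ G (snd s) ^^ n) v = fst s"
    using assms by (auto simp: leads_to_def split: prod.splits)
  then show ?thesis
    using funpow_update_reaches[of n "rotor_succ G (snd s)" v "fst s" "fst (rotor_router G nxt s)"]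
    unfolding leads_to_def case_prod_beta rotor_succ_router by blast
qed

lemma leads_to_funpow_router:
  "leads_to G s v \<Longrightarrow> leads_to G ((rotor_router G nxt ^^ n) s) v"
  by (induction n) (simp_all add: leads_to_router)

lemma leads_to_chip: "leads_to G s (fst s)"
  by (auto simp: leads_to_def split: prod.split intro: exI[of _ 0])

text \<open>Take for \<open>m\<close> the first visit to \<open>v\<close>: a step turns only the
  rotor under the chip.\<close>

lemma rotor_kept_until_visit:
  "fst ((rotor_router G nxt ^^ n) s) = v \<Longrightarrow>
    \<exists>m. fst ((rotor_router G nxt ^^ m) s) = v \<and> snd ((rotor_router G nxt ^^ m) s) v = snd s v"
proof (induction n arbitrary: s)
  case (Suc n)
  show ?case
  proof (cases "fst s = v")
    case False
    have "fst ((rotor_router G nxt ^^ n) (rotor_router G nxt s)) = v"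
      using Suc.prems by (simp add: funpow_swap1)
    then obtain m where
      "fst ((rotor_router G nxt ^^ m) (rotor_router G nxt s)) = v"
      "snd ((rotor_router G nxt ^^ m) (rotor_router G nxt s)) v = snd (rotor_router G nxt s) v"
      using Suc.IH by blast
    then show ?thesis
      using False by (intro exI[of _ "Suc m"]) (simp add: funpow_swap1 rotor_router_simps)
  qed (auto intro: exI[of _ 0])
qed (auto intro: exI[of _ 0])

section \<open>Closure of chip-and-rotor states under the router\<close>

locale rotor_digraph = fin_digraph G for G :: "('v, 'e) pre_digraph" +
  fixes nxt :: "'e \<Rightarrow> 'e"
  assumes sink_free: "sink_free G"
    and edge_ordering: "edge_ordering G nxt"
begin

lemma cyclic_on_out_arcs: "v \<in> verts G \<Longrightarrow> cyclic_on nxt (out_arcs G v)"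
  using sink_free edge_ordering by (auto simp: sink_free_def edge_ordering_def)

lemma rotor_configD:
  assumes "rotor_config G \<rho>" "v \<in> verts G"
  shows "\<rho> v \<in> arcs G" "tail G (\<rho> v) = v" "rotor_succ G \<rho> v \<in> verts G"
  using assms by (auto simp: rotor_config_def rotor_succ_def)

lemma funpow_rotor_succ_in_verts:
  assumes "rotor_config G \<rho>" "v \<in> verts G"
  shows "(rotor_succ G \<rho> ^^ n) v \<in> verts G"
  using assms by (induction n) (auto intro: rotor_configD)

lemma chip_rotor_state_router:
  assumes "chip_rotor_state G s"
  shows "chip_rotor_state G (rotor_router G nxt s)"
proof -
  obtain w \<rho> where s: "s = (w, \<rho>)" by force
  have "nxt (\<rho> w) \<in> out_arcs G w"
    using assms s cyclic_on_inI[OF cyclic_on_out_arcs, of w "\<rho> w"]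
    by (auto simp: chip_rotor_state_def rotor_config_def)
  then show ?thesis
    using assms s by (auto simp: chip_rotor_state_def rotor_config_def rotor_router_def)
qed

lemma chip_rotor_state_orbit:
  assumes "t \<in> orbit (rotor_router G nxt) s" "chip_rotor_state G s"
  shows "chip_rotor_state G t"
  using assms by induction (auto intro: chip_rotor_state_router)

section \<open>Recurrent chips visit every reachable vertex\<close>

text \<open>Induction along the cyclic ordering: after \<open>e\<close> is fired, periodicity brings
  the chip back, and at the first return the rotor still points along \<open>e\<close>, so
  \<open>nxt e\<close> is fired next.\<close>

lemma recurrent_fires_all_arcs:
  assumes s: "chip_rotor_state G s" and rec: "s \<in> orbit (rotor_router G nxt) s"
    and e: "e \<in> out_arcs G (fst s)"
  shows "\<exists>t \<in> orbit (rotor_router G nxt) s. fst t = fst s \<and> nxt (snd t (fst s)) = e"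
proof -
  let ?F = "rotor_router G nxt"
  have "out_arcs G (fst s) = orbit nxt (snd s (fst s))"
    using s orbit_cyclic_eq3[OF cyclic_on_out_arcs, of "fst s" "snd s (fst s)"]
    by (auto simp: chip_rotor_state_def rotor_config_def split: prod.splits)
  with e have "e \<in> orbit nxt (snd s (fst s))" by simp
  then show ?thesis
  proof induction
    case base
    \<comment> \<open>The state \<open>s\<close> is its own witness: it fires the edge with which
      the orbit of its rotor begins.\<close>
    show ?case using rec by blast
  next
    case (step e)
    then obtain t where t: "t \<in> orbit ?F s" "fst t = fst s" "nxt (snd t (fst s)) = e" by blast
    \<comment> \<open>The return is sought from \<open>?F t\<close>, not from \<open>t\<close>, so
      that it comes after the firing of \<open>e\<close>.\<close>
    have eq: "orbit ?F (?F t) = orbit ?F s"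
      by (rule periodic_orbit_eq[OF rec orbit.step[OF t(1)]])
    with t(1) have "t \<in> orbit ?F (?F t)" by simp
    then have "(?F ^^ funpow_dist ?F (?F t) t) (?F t) = t" by (rule funpow_dist_prop)
    then have "fst ((?F ^^ funpow_dist ?F (?F t) t) (?F t)) = fst s" using t(2) by simp
    from rotor_kept_until_visit[OF this] obtain m where
      m: "fst ((?F ^^ m) (?F t)) = fst s" "snd ((?F ^^ m) (?F t)) (fst s) = snd (?F t) (fst s)"
      by blast
    moreover have "(?F ^^ m) (?F t) \<in> orbit ?F s"
      using t(1) by (intro funpow_in_orbit orbit.step)
    ultimately show ?case
      using t by (intro bexI[of _ "(?F ^^ m) (?F t)"]) (simp_all add: rotor_router_simps)
  qed
qed

lemma recurrent_visits_reachable: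
  assumes s: "chip_rotor_state G s" and rec: "s \<in> orbit (rotor_router G nxt) s"
    and "fst s \<rightarrow>\<^sup>*\<^bsub>G\<^esub> v"
  shows "\<exists>t \<in> orbit (rotor_router G nxt) s. fst t = v"
  using assms(3)
proof (induction rule: reachable_induct)
  case base
  show ?case using rec by blast
next
  case (step x y)
  then obtain t where t: "t \<in> orbit (rotor_router G nxt) s" "fst t = x" by blast
  obtain e where "e \<in> out_arcs G x" "head G e = y"
    using step by auto
  \<comment> \<open>The firing lemma speaks of the chip's own vertex, so it is applied at
    \<open>t\<close>, which is recurrent because it lies on a periodic orbit.\<close>
  then obtain t' where t': "t' \<in> orbit (rotor_router G nxt) t" "fst t' = x" "nxt (snd t' x) = e"
    using recurrent_fires_all_arcs[OF chip_rotor_state_orbit[OF t(1) s] self_in_orbit_trans[OF rec t(1)]]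
      t(2) by blast
  have "rotor_router G nxt t' \<in> orbit (rotor_router G nxt) s"
    using t' t by (meson orbit.step orbit_trans)
  then show ?case
    using t' \<open>head G e = y\<close>
    by (intro bexI[of _ "rotor_router G nxt t'"]) (simp_all add: rotor_router_simps)
qed

text \<open>When the chip is at \<open>v\<close>, trivially \<open>v\<close> leads to it; this
  persists along the rest of the run, which returns to \<open>s\<close>.\<close>

lemma recurrent_leads_to:
  assumes s: "chip_rotor_state G s" and rec: "s \<in> orbit (rotor_router G nxt) s"
    and "fst s \<rightarrow>\<^sup>*\<^bsub>G\<^esub> v"
  shows "leads_to G s v"
proof -
  obtain t where t: "t \<in> orbit (rotor_router G nxt) s" "fst t = v"
    using recurrent_visits_reachable[OF assms] by blast
  obtain n where n: "(rotor_router G nxt ^^ n) t = s"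
    using funpow_dist_prop[OF orbit_swap[OF rec t(1)]] by blast
  have "leads_to G t v"
    using leads_to_chip[of G t] t(2) by simp
  then show ?thesis
    unfolding n[symmetric] by (rule leads_to_funpow_router)
qed

section \<open>Injectivity of the router and recurrence of spanning states\<close>

text \<open>In such a state the rotors away from the chip form a spanning tree oriented towards
  it.\<close>

definition spanning_states :: "('v, 'e) chip_rotor set" where
  "spanning_states = {s. chip_rotor_state G s \<and> (\<forall>v \<in> verts G. leads_to G s v)}"

lemma router_spanning_states: "s \<in> spanning_states \<Longrightarrow> rotor_router G nxt s \<in> spanning_states"
  by (simp add: spanning_states_def chip_rotor_state_router leads_to_router)

text \<open>Before the step the new chip position leads to the old one, and it still does
  afterwards; the turned rotor closes this path to a cycle.\<close>

lemma old_chip_in_new_orbit: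
  assumes "s \<in> spanning_states" and t: "t = rotor_router G nxt s"
  shows "fst s \<in> orbit (rotor_succ G (snd t)) (fst s)"
    and "rotor_succ G (snd t) (fst s) = fst t"
proof -
  show succ: "rotor_succ G (snd t) (fst s) = fst t"
    by (simp add: t rotor_succ_router)
  have "fst t \<in> verts G"
    using router_spanning_states[OF assms(1)] t
    by (auto simp: spanning_states_def chip_rotor_state_def split: prod.splits)
  then obtain n where "(rotor_succ G (snd s) ^^ n) (fst t) = fst s"
    using assms(1) by (auto simp: spanning_states_def leads_to_def split: prod.splits)
  then obtain m where "(rotor_succ G (snd t) ^^ m) (fst t) = fst s"
    using funpow_update_reaches[of n "rotor_succ G (snd s)" "fst t" "fst s" "fst t"]
      rotor_succ_router[of G nxt s] t by auto
  then have "(rotor_succ G (snd t) ^^ Suc m) (fst s) = fst s"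
    using succ by (simp add: funpow_swap1)
  then show "fst s \<in> orbit (rotor_succ G (snd t)) (fst s)"
    by (rule funpow_self_in_orbit) simp
qed

lemma inj_on_router: "inj_on (rotor_router G nxt) spanning_states"
proof (rule inj_onI)
  fix s s' assume S: "s \<in> spanning_states" "s' \<in> spanning_states"
    and eq: "rotor_router G nxt s = rotor_router G nxt s'"
  define t where t: "t = rotor_router G nxt s"
  define f where "f = rotor_succ G (snd t)"
  have s: "fst s \<in> orbit f (fst s)" "f (fst s) = fst t"
    and s': "fst s' \<in> orbit f (fst s')" "f (fst s') = fst t"
    using old_chip_in_new_orbit[OF S(1) t] old_chip_in_new_orbit[OF S(2)] t eq
    unfolding f_def by auto
  \<comment> \<open>Both old positions are periodic and have image \<open>fst t\<close>, so both
    orbits are that of \<open>fst t\<close>, where \<open>f\<close> is injective.\<close>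
  have orb: "orbit f (fst s) = orbit f (fst s')"
    using s s' self_in_orbit_step by metis
  have w: "fst s = fst s'"
    using inj_onD[OF inj_on_periodic_orbit[OF s(1)], of "fst s" "fst s'"] s s' orb by simp
  have upd: "(snd s)(fst s := nxt (snd s (fst s))) = (snd s')(fst s := nxt (snd s' (fst s)))"
    using eq w by (metis rotor_router_simps(2))
  have out: "fst s \<in> verts G" "snd s (fst s) \<in> out_arcs G (fst s)"
    "snd s' (fst s) \<in> out_arcs G (fst s)"
    using S w by (auto simp: spanning_states_def chip_rotor_state_def rotor_config_def
        split: prod.splits)
  \<comment> \<open>The edges at a vertex form one periodic orbit of \<open>nxt\<close>, so the turn
    of the rotor can be undone.\<close>
  have "inj_on nxt (out_arcs G (fst s))"
    using inj_on_periodic_orbit cyclic_on_out_arcs[OF out(1)] unfolding cyclic_on_def by metis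
  then have "snd s (fst s) = snd s' (fst s)"
    using out fun_cong[OF upd, of "fst s"] by (auto dest: inj_onD)
  moreover have "snd s v = snd s' v" if "v \<noteq> fst s" for v
    using fun_cong[OF upd, of v] that by simp
  ultimately have "snd s = snd s'" by (metis ext)
  with w show "s = s'" by (rule prod_eqI)
qed

text \<open>
  The unconstrained values of a configuration outside \<open>verts G\<close> are frozen here to keep the set
  of states finite.
\<close>
lemma finite_states:
  "finite {s. chip_rotor_state G s \<and> (\<forall>v. v \<notin> verts G \<longrightarrow> snd s v = \<sigma> v)}" (is "finite ?S")
proof (rule finite_subset)
  show "?S \<subseteq> verts G \<times> (\<lambda>g. override_on \<sigma> g (verts G)) ` (\<Pi>\<^sub>E v \<in> verts G. arcs G)"
  proof
    fix s assume s: "s \<in> ?S"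
    have "snd s = override_on \<sigma> (restrict (snd s) (verts G)) (verts G)"
      using s by (auto simp: override_on_def)
    moreover have "restrict (snd s) (verts G) \<in> (\<Pi>\<^sub>E v \<in> verts G. arcs G)"
      using s by (auto simp: chip_rotor_state_def rotor_config_def split: prod.splits)
    ultimately have "snd s \<in> (\<lambda>g. override_on \<sigma> g (verts G)) ` (\<Pi>\<^sub>E v \<in> verts G. arcs G)"
      by blast
    moreover have "fst s \<in> verts G"
      using s by (auto simp: chip_rotor_state_def)
    ultimately show "s \<in> verts G \<times> (\<lambda>g. override_on \<sigma> g (verts G)) ` (\<Pi>\<^sub>E v \<in> verts G. arcs G)"
      by (simp add: mem_Times_iff)
  qed
  show "finite (verts G \<times> (\<lambda>g. override_on \<sigma> g (verts G)) ` (\<Pi>\<^sub>E v \<in> verts G. arcs G))"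
    by (intro finite_cartesian_product finite_imageI finite_PiE) simp_all
qed

text \<open>An injective self-map of a finite set has only periodic points; the finite set consists
  of the spanning states that agree with \<open>s\<close> outside \<open>verts G\<close>.\<close>

lemma spanning_state_recurrent:
  assumes "s \<in> spanning_states"
  shows "s \<in> orbit (rotor_router G nxt) s"
proof (rule inj_on_self_in_orbit)
  let ?A = "{t \<in> spanning_states. \<forall>v. v \<notin> verts G \<longrightarrow> snd t v = snd s v}"
  show "finite ?A"
    by (rule finite_subset[OF _ finite_states[of "snd s"]]) (auto simp: spanning_states_def)
  show "inj_on (rotor_router G nxt) ?A"
    by (rule inj_on_subset[OF inj_on_router]) blast
  show "rotor_router G nxt ` ?A \<subseteq> ?A"
  proof (rule image_subsetI)
    fix t assume t: "t \<in> ?A"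
    then have "fst t \<in> verts G"
      by (auto simp: spanning_states_def chip_rotor_state_def)
    with t show "rotor_router G nxt t \<in> ?A"
      by (auto simp: router_spanning_states rotor_router_simps)
  qed
  show "s \<in> ?A" using assms by simp
qed

section \<open>Directed cycles of rotor edges as periodic orbits\<close>

text \<open>A walk along rotor edges has no choice: \<open>\<rho> u\<close> is the only rotor edge
  with tail \<open>u\<close>.\<close>

lemma awalk_rotorsD:
  assumes "rotor_config G \<rho>" "awalk u p v" "set p \<subseteq> \<rho> ` verts G"
  shows "p = map (\<lambda>i. \<rho> ((rotor_succ G \<rho> ^^ i) u)) [0..<length p]
    \<and> v = (rotor_succ G \<rho> ^^ length p) u"
  using assms(2,3)
proof (induction p arbitrary: u)
  case (Cons e p)
  then have "e = \<rho> u"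
    using rotor_configD[OF assms(1)] by (auto simp: awalk_Cons_iff)
  then have "awalk (rotor_succ G \<rho> u) p v"
    using Cons.prems by (simp add: awalk_Cons_iff rotor_succ_def)
  then show ?case
    using Cons.IH[of "rotor_succ G \<rho> u"] Cons.prems \<open>e = \<rho> u\<close>
    by (simp add: map_upt_Suc funpow_swap1 del: upt_Suc)
qed (auto simp: awalk_Nil_iff)

lemma awalk_rotors:
  assumes "rotor_config G \<rho>" "u \<in> verts G"
  shows "awalk u (map (\<lambda>i. \<rho> ((rotor_succ G \<rho> ^^ i) u)) [0..<n]) ((rotor_succ G \<rho> ^^ n) u)"
  using assms(2)
proof (induction n arbitrary: u)
  case (Suc n)
  have "awalk (rotor_succ G \<rho> u) (map (\<lambda>i. \<rho> ((rotor_succ G \<rho> ^^ i) (rotor_succ G \<rho> u))) [0..<n])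
    ((rotor_succ G \<rho> ^^ n) (rotor_succ G \<rho> u))"
    using Suc rotor_configD[OF assms(1)] by blast
  then show ?case
    using rotor_configD[OF assms(1) Suc.prems] rotor_succ_def[of G \<rho> u, symmetric]
    by (simp add: map_upt_Suc funpow_swap1 awalk_Cons_iff del: upt_Suc)
qed (simp add: awalk_Nil_iff)

lemma directed_cycle_rotors_iff:
  assumes \<rho>: "rotor_config G \<rho>"
  shows "directed_cycle G C \<and> C \<subseteq> \<rho> ` verts G \<longleftrightarrow>
    (\<exists>u \<in> verts G. u \<in> orbit (rotor_succ G \<rho>) u \<and> C = \<rho> ` orbit (rotor_succ G \<rho>) u)"
    (is "?L \<longleftrightarrow> ?R")
proof
  let ?f = "rotor_succ G \<rho>"
  assume ?L
  then obtain u p where p: "awalk u p u" "p \<noteq> []" "C = set p" "set p \<subseteq> \<rho> ` verts G"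
    by (auto simp: directed_cycle_def cycle_def)
  then have walk: "p = map (\<lambda>i. \<rho> ((?f ^^ i) u)) [0..<length p]" and per: "(?f ^^ length p) u = u"
    using awalk_rotorsD[OF \<rho>] by auto
  have "C = (\<lambda>i. \<rho> ((?f ^^ i) u)) ` {0..<length p}"
    using p(3) walk by (metis list.set_map set_upt)
  also have "\<dots> = \<rho> ` {(?f ^^ i) u | i. i < length p}"
    by (force simp: image_iff)
  \<comment> \<open>Any positive period, such as \<open>length p\<close>, bounds the iterates needed
    to list the orbit.\<close>
  also have "\<dots> = \<rho> ` orbit ?f u"
    using orbit_altdef_bounded[OF per] p(2) by simp
  finally have "C = \<rho> ` orbit ?f u" .
  moreover have "u \<in> orbit ?f u"
    using per p(2) by (auto intro: funpow_self_in_orbit)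
  ultimately show ?R using p(1) by auto
next
  let ?f = "rotor_succ G \<rho>"
  assume ?R
  then obtain u where u: "u \<in> verts G" "u \<in> orbit ?f u" "C = \<rho> ` orbit ?f u" by blast
  \<comment> \<open>The least period, so that \<open>p\<close> runs round the cycle exactly
    once.\<close>
  define n where "n = funpow_dist1 ?f u u"
  define p where "p = map (\<lambda>i. \<rho> ((?f ^^ i) u)) [0..<n]"
  have n: "n > 0" "(?f ^^ n) u = u"
    unfolding n_def using funpow_dist1_prop[OF u(2)] by simp_all
  have walk: "awalk u p u"
    using awalk_rotors[OF \<rho> u(1), of n] n(2) p_def by simp
  have "p \<noteq> []" using n(1) p_def by simp
  have "inj_on (\<lambda>i. (?f ^^ i) u) {0..<n}"
    unfolding n_def by (rule inj_on_funpow_dist1[OF u(2)])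
  \<comment> \<open>\<open>cycle\<close> requires the vertices after the first, which are the heads
    of the edges, to be distinct; hence the extra application of \<open>?f\<close>.\<close>
  then have "inj_on (\<lambda>i. ?f ((?f ^^ i) u)) {0..<n}"
    using inj_on_subset[OF inj_on_periodic_orbit[OF u(2)], of "(\<lambda>i. (?f ^^ i) u) ` {0..<n}"]
      funpow_in_orbit[OF u(2)] comp_inj_on[of "\<lambda>i. (?f ^^ i) u" "{0..<n}" ?f]
    by (auto simp: comp_def)
  moreover have "tl (awalk_verts u p) = map (\<lambda>i. ?f ((?f ^^ i) u)) [0..<n]"
    using walk \<open>p \<noteq> []\<close> awalk_verts_conv'[of u p u]
    by (simp add: awalk_def p_def rotor_succ_def comp_def)
  ultimately have "cycle p"
    using walk \<open>p \<noteq> []\<close> by (auto simp: cycle_def distinct_map)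
  moreover have C: "C = set p"
    using u(3) orbit_conv_funpow_dist1[OF u(2), folded n_def]
    by (simp add: p_def image_image)
  moreover have "C \<subseteq> \<rho> ` verts G"
    unfolding C p_def using funpow_rotor_succ_in_verts[OF \<rho> u(1)] by auto
  ultimately show ?L by (auto simp: directed_cycle_def)
qed

text \<open>By pigeonhole the arrows from \<open>v\<close> eventually run into a cycle.\<close>

lemma leads_to_periodic:
  assumes "rotor_config G \<rho>" "v \<in> verts G"
  obtains u where "u \<in> verts G" "u \<in> orbit (rotor_succ G \<rho>) u" "leads_to G (u, \<rho>) v"
proof -
  have "rotor_succ G \<rho> ` verts G \<subseteq> verts G"
    using rotor_configD[OF assms(1)] by auto
  then obtain i d where "d > 0" "(rotor_succ G \<rho> ^^ i) v = (rotor_succ G \<rho> ^^ (i + d)) v"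
    using finite_orbit_returns[OF finite_verts _ assms(2)] by metis
  then have "(rotor_succ G \<rho> ^^ i) v \<in> orbit (rotor_succ G \<rho>) ((rotor_succ G \<rho> ^^ i) v)"
    by (intro funpow_self_in_orbit[of d]) (simp_all add: funpow_add add.commute[of i])
  then show thesis
    using that[of "(rotor_succ G \<rho> ^^ i) v"] funpow_rotor_succ_in_verts[OF assms]
    by (auto simp: leads_to_def)
qed

lemma tail_image_rotors:
  assumes "rotor_config G \<rho>" "u \<in> verts G"
  shows "tail G ` \<rho> ` orbit (rotor_succ G \<rho>) u = orbit (rotor_succ G \<rho>) u"
proof -
  have "tail G (\<rho> v) = v" if "v \<in> orbit (rotor_succ G \<rho>) u" for v
    using that rotor_configD(2)[OF assms(1)] funpow_rotor_succ_in_verts[OF assms]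
    unfolding orbit_altdef by auto
  then show ?thesis by (auto simp: image_image)
qed

section \<open>Unicycles as spanning states, and the equivalence\<close>

text \<open>Every vertex runs into some cycle; if only one exists and it contains \<open>w\<close>,
  then every vertex leads to \<open>w\<close>. Conversely, if all vertices lead to \<open>w\<close>,
  then \<open>w\<close> is periodic, and every cycle, being closed under the arrows, contains
  \<open>w\<close> and so is its orbit.\<close>

lemma unicycle_iff_spanning: "unicycle G s \<longleftrightarrow> s \<in> spanning_states"
proof
  obtain w \<rho> where s: "s = (w, \<rho>)" by force
  let ?f = "rotor_succ G \<rho>"
  assume "unicycle G s"
  then have \<rho>: "rotor_config G \<rho>" and state: "chip_rotor_state G s"
    and uni: "\<exists>C. (\<forall>C'. directed_cycle G C' \<and> C' \<subseteq> \<rho> ` verts G \<longrightarrow> C' = C) \<and> w \<in> tail G ` C"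
    by (auto simp: s unicycle_def chip_rotor_state_def)
  obtain C where C: "\<And>C'. directed_cycle G C' \<and> C' \<subseteq> \<rho> ` verts G \<Longrightarrow> C' = C" "w \<in> tail G ` C"
    using uni by blast
  have "leads_to G s v" if v: "v \<in> verts G" for v
  proof -
    obtain u where u: "u \<in> verts G" "u \<in> orbit ?f u" "leads_to G (u, \<rho>) v"
      using leads_to_periodic[OF \<rho> v] .
    have "\<rho> ` orbit ?f u = C"
      using u(1,2) by (intro C(1)) (auto simp: directed_cycle_rotors_iff[OF \<rho>])
    then have "w \<in> orbit ?f u"
      using C(2) tail_image_rotors[OF \<rho> u(1)] by simp
    then obtain m where "(?f ^^ m) u = w"
      using funpow_dist_prop by metis
    moreover obtain k where "(?f ^^ k) v = u"
      using u(3) by (auto simp: leads_to_def)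
    ultimately have "(?f ^^ (m + k)) v = w"
      by (simp add: funpow_add)
    then show ?thesis
      by (auto simp: s leads_to_def)
  qed
  with state show "s \<in> spanning_states" by (simp add: spanning_states_def)
next
  obtain w \<rho> where s: "s = (w, \<rho>)" by force
  let ?f = "rotor_succ G \<rho>"
  assume "s \<in> spanning_states"
  then have \<rho>: "rotor_config G \<rho>" and w: "w \<in> verts G" and state: "chip_rotor_state G s"
    and lead: "\<And>v. v \<in> verts G \<Longrightarrow> \<exists>n. (?f ^^ n) v = w"
    by (auto simp: s spanning_states_def chip_rotor_state_def leads_to_def)
  \<comment> \<open>Starting at \<open>?f w\<close> makes the return to \<open>w\<close> take a
    positive number of steps.\<close>
  obtain n where "(?f ^^ n) (?f w) = w"
    using lead rotor_configD(3)[OF \<rho> w] by blast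
  then have per: "w \<in> orbit ?f w"
    by (intro funpow_self_in_orbit[of "Suc n"]) (simp_all add: funpow_swap1)
  have "C' = \<rho> ` orbit ?f w" if C': "directed_cycle G C' \<and> C' \<subseteq> \<rho> ` verts G" for C'
  proof -
    obtain u where u: "u \<in> verts G" "u \<in> orbit ?f u" "C' = \<rho> ` orbit ?f u"
      using C' unfolding directed_cycle_rotors_iff[OF \<rho>] by blast
    have "w \<in> orbit ?f u"
      using lead[OF u(1)] funpow_in_orbit[OF u(2)] by blast
    then show ?thesis
      using u periodic_orbit_eq by metis
  qed
  moreover have "directed_cycle G (\<rho> ` orbit ?f w) \<and> \<rho> ` orbit ?f w \<subseteq> \<rho> ` verts G"
    unfolding directed_cycle_rotors_iff[OF \<rho>] using w per by blast
  moreover have "w \<in> tail G ` \<rho> ` orbit ?f w"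
    using tail_image_rotors[OF \<rho> w] per by simp
  ultimately show "unicycle G s"
    using state unfolding s unicycle_def by blast
qed

text \<open>Strong connectivity makes every vertex reachable from the chip, so a recurrent state is
  spanning; the converse is the periodicity of spanning states.\<close>

lemma recurrent_iff_unicycle:
  assumes "strongly_connected G" "chip_rotor_state G s"
  shows "recurrent G nxt s \<longleftrightarrow> unicycle G s"
proof -
  have "recurrent G nxt s \<longleftrightarrow> s \<in> orbit (rotor_router G nxt) s"
    by (force simp: recurrent_def orbit_altdef)
  also have "\<dots> \<longleftrightarrow> s \<in> spanning_states"
  proof
    assume rec: "s \<in> orbit (rotor_router G nxt) s"
    have "fst s \<rightarrow>\<^sup>*\<^bsub>G\<^esub> v" if "v \<in> verts G" for v
      using that assms by (auto simp: strongly_connected_def chip_rotor_state_def)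
    then show "s \<in> spanning_states"
      using recurrent_leads_to[OF assms(2) rec] assms(2) by (simp add: spanning_states_def)
  qed (rule spanning_state_recurrent)
  finally show ?thesis by (simp add: unicycle_iff_spanning)
qed

end

theorem theorem3p8:
  fixes G :: "('v, 'e) pre_digraph"
    and nxt :: "'e \<Rightarrow> 'e"
    and w :: 'v
    and \<rho> :: "'v \<Rightarrow> 'e"
  assumes "fin_digraph G"
    and "strongly_connected G"
    and "sink_free G"
    and "edge_ordering G nxt"
    and "chip_rotor_state G (w, \<rho>)"
  shows "recurrent G nxt (w, \<rho>) \<longleftrightarrow> unicycle G (w, \<rho>)"
proof -
  interpret rotor_digraph G nxt
    using assms by (intro rotor_digraph.intro rotor_digraph_axioms.intro)
  show ?thesis
    using assms(2,5) by (rule recurrent_iff_unicycle)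
qed

end
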